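(* Let $n\geq 1$ be an integer, let $\tau,\tau'\in\mathbb{C}\setminus\mathbb{R}$, and let $E=\mathbb{C}/(\mathbb{Z}+\mathbb{Z}\tau)$ and $E'=\mathbb{C}/(\mathbb{Z}+\mathbb{Z}\tau')$ be the corresponding elliptic curves. Set $A':=E^{2n}\times E'$, let $w\in A'$ be the point of order $2$ given by $w:=(1/2,1/2,\dots,1/2,0)$ (the first $2n$ coordinates are the class of $1/2$ in $E$ and the last coordinate is $0\in E'$), and let $A:=A'/\langle w\rangle$. Then the Abelian variety $A$ admits a free action with no translations of the dihedral group $D_{4n}$ of order $8n$.
   Context: For an integer $k\geq 1$, $D_k:=\langle r,s \mid r^k=1,\ s^2=1,\ (rs)^2=1\rangle$ denotes the dihedral group of order $2k$. An action of a finite group $G$ on an Abelian variety (over $\mathbb{C}$) $A$ is by automorphisms of $A$ as an algebraic variety (equivalently, by biholomorphisms); these are not required to fix the origin or to be group homomorphisms. The action is free if no non-identity element of $G$ has a fixed point in $A$. It is "with no translations" (or "contains no translations") if no non-identity element of $G$ acts on $A$ as a translation $x\mapsto x+a$ with $a\in A$ (including $a=0$, so in particular the action is faithful). *)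

theory Defs
  imports "HOL-Analysis.Analysis" "HOL-Algebra.Group_Action" "HOL-Algebra.Product_Groups"
begin

section \<open>Groups given by generators and relations\<close>

text \<open>
  A word is a list of letters \<open>(x, b)\<close>: the letter \<open>(x, True)\<close> is the generator \<open>x\<close>
  and \<open>(x, False)\<close> is its formal inverse.  Two words are equal in the group
  presented by the relators \<open>R\<close> iff they are related by the congruence generated by free
  cancellation and by deletion of relators.
\<close>

type_synonym 'g word = "('g \<times> bool) list"

inductive word_eq :: "'g word set \<Rightarrow> 'g word \<Rightarrow> 'g word \<Rightarrow> bool" for R where
  refl: "word_eq R u u"
| sym: "word_eq R u v \<Longrightarrow> word_eq R v u"
| trans: "word_eq R u v \<Longrightarrow> word_eq R v w \<Longrightarrow> word_eq R u w"
| cancel: "word_eq R (u @ [(x, b), (x, \<not> b)] @ v) (u @ v)"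
| relator: "w \<in> R \<Longrightarrow> word_eq R (u @ w @ v) (u @ v)"

definition presented_group :: "'g word set \<Rightarrow> 'g word set monoid" where
  "presented_group R =
    \<lparr>carrier = UNIV // {(u, v). word_eq R u v},
     mult = (\<lambda>X Y. {w. \<exists>u\<in>X. \<exists>v\<in>Y. word_eq R (u @ v) w}),
     one = {w. word_eq R [] w}\<rparr>"

datatype dihedral_gen = Rot | Ref

definition dihedral :: "nat \<Rightarrow> dihedral_gen word set monoid" where
  "dihedral k = presented_group
    {replicate k (Rot, True),
     [(Ref, True), (Ref, True)],
     [(Rot, True), (Ref, True), (Rot, True), (Ref, True)]}"


section \<open>The Abelian variety\<close>

definition complex_add :: "complex monoid" where
  "complex_add = \<lparr>carrier = UNIV, mult = (+), one = 0\<rparr>"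

definition lattice :: "complex \<Rightarrow> complex set" where
  "lattice \<tau> = {of_int a + of_int b * \<tau> | a b. True}"

definition elliptic :: "complex \<Rightarrow> complex set monoid" where
  "elliptic \<tau> = complex_add Mod lattice \<tau>"

definition elliptic_pt :: "complex \<Rightarrow> complex \<Rightarrow> complex set" where
  "elliptic_pt \<tau> z = lattice \<tau> #>\<^bsub>complex_add\<^esub> z"

type_synonym 'm cover_pt = "('m \<Rightarrow> complex set) \<times> complex set"

text \<open>The index type \<open>'m\<close> labels the factors of the power of \<open>E\<close>.\<close>

definition cover_group :: "complex \<Rightarrow> complex \<Rightarrow> 'm::finite cover_pt monoid" where
  "cover_group \<tau> \<tau>' = product_group UNIV (\<lambda>_. elliptic \<tau>) \<times>\<times> elliptic \<tau>'"

definition w_pt :: "complex \<Rightarrow> complex \<Rightarrow> 'm::finite cover_pt" where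
  "w_pt \<tau> \<tau>' = ((\<lambda>_. elliptic_pt \<tau> (1/2)), elliptic_pt \<tau>' 0)"

definition abvar :: "complex \<Rightarrow> complex \<Rightarrow> 'm::finite cover_pt set monoid" where
  "abvar \<tau> \<tau>' = cover_group \<tau> \<tau>' Mod generate (cover_group \<tau> \<tau>') {w_pt \<tau> \<tau>'}"

text \<open>
  The universal covering map onto \<^term>\<open>abvar \<tau> \<tau>'\<close>; the coordinate \<open>None\<close> belongs to the
  last factor.
\<close>

definition proj :: "complex \<Rightarrow> complex \<Rightarrow> complex ^ ('m::finite option) \<Rightarrow> 'm cover_pt set" where
  "proj \<tau> \<tau>' z = generate (cover_group \<tau> \<tau>') {w_pt \<tau> \<tau>'} #>\<^bsub>cover_group \<tau> \<tau>'\<^esub>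
     ((\<lambda>i. elliptic_pt \<tau> (z $ Some i)), elliptic_pt \<tau>' (z $ None))"


section \<open>Biholomorphic maps\<close>

definition holomorphic_vec_on ::
    "(complex ^ 'k::finite \<Rightarrow> complex ^ 'l::finite) \<Rightarrow> (complex ^ 'k) set \<Rightarrow> bool" where
  "holomorphic_vec_on f U \<longleftrightarrow>
    (\<forall>z\<in>U. \<exists>D. (f has_derivative D) (at z within U) \<and> (\<forall>c v. D (c *s v) = c *s D v))"

text \<open>
  Let \<open>p\<close> be a holomorphic covering of a complex manifold by affine space.  The charts of that
  manifold are the local inverses \<open>inv_into U p\<close> of \<open>p\<close>, for \<open>U\<close> open with \<open>p\<close> injective
  on \<open>U\<close>, and holomorphy of a self-map \<open>f\<close> is tested in these charts.  The inclusion
  of \<open>f ` p ` U\<close> in the domain of a chart makes continuity of \<open>f\<close> part of the condition.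
\<close>

definition holomorphic_via ::
    "(complex ^ 'k::finite \<Rightarrow> 'x) \<Rightarrow> ('x \<Rightarrow> 'x) \<Rightarrow> bool" where
  "holomorphic_via p f \<longleftrightarrow>
    (\<forall>z. \<exists>U V. open U \<and> z \<in> U \<and> inj_on p U \<and> open V \<and> inj_on p V \<and> f ` p ` U \<subseteq> p ` V \<and>
       holomorphic_vec_on (inv_into V p \<circ> f \<circ> p) U)"

definition biholomorphic_via ::
    "(complex ^ 'k::finite \<Rightarrow> 'x) \<Rightarrow> ('x \<Rightarrow> 'x) \<Rightarrow> bool" where
  "biholomorphic_via p f \<longleftrightarrow>
    bij_betw f (range p) (range p) \<and> holomorphic_via p f \<and>
    holomorphic_via p (inv_into (range p) f)"


section \<open>Actions on the Abelian variety\<close>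

definition acts_by_automorphisms ::
    "complex \<Rightarrow> complex \<Rightarrow> ('g, 'c) monoid_scheme \<Rightarrow>
     ('g \<Rightarrow> 'm::finite cover_pt set \<Rightarrow> 'm cover_pt set) \<Rightarrow> bool" where
  "acts_by_automorphisms \<tau> \<tau>' G \<phi> \<longleftrightarrow>
    group_action G (carrier (abvar \<tau> \<tau>')) \<phi> \<and>
    (\<forall>g\<in>carrier G. biholomorphic_via (proj \<tau> \<tau>') (\<phi> g))"

definition free_action :: "('g, 'c) monoid_scheme \<Rightarrow> 'x set \<Rightarrow> ('g \<Rightarrow> 'x \<Rightarrow> 'x) \<Rightarrow> bool" where
  "free_action G X \<phi> \<longleftrightarrow> (\<forall>g\<in>carrier G. g \<noteq> \<one>\<^bsub>G\<^esub> \<longrightarrow> (\<forall>x\<in>X. \<phi> g x \<noteq> x))"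

definition is_translation :: "('a, 'c) monoid_scheme \<Rightarrow> ('a \<Rightarrow> 'a) \<Rightarrow> bool" where
  "is_translation A f \<longleftrightarrow> (\<exists>a\<in>carrier A. \<forall>x\<in>carrier A. f x = x \<otimes>\<^bsub>A\<^esub> a)"

definition without_translations ::
    "('g, 'c) monoid_scheme \<Rightarrow> ('a, 'd) monoid_scheme \<Rightarrow> ('g \<Rightarrow> 'a \<Rightarrow> 'a) \<Rightarrow> bool" where
  "without_translations G A \<phi> \<longleftrightarrow> (\<forall>g\<in>carrier G. g \<noteq> \<one>\<^bsub>G\<^esub> \<longrightarrow> \<not> is_translation A (\<phi> g))"

end

(* On the universal cover C^(2n) x C of A, extend the first 2n coordinates of z to an antiperiodic
   sequence (z_j), j in Z, with z_(j+2n) = -z_j.  Put a_j = (tau + j)/2, which modulo Z + Z tau is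
   antiperiodic too, and
     r : z_j -> z_(j+1),             z' -> z' + 1/(4n),
     s : z_j -> z_(2n-1-j) + a_j,    z' -> -z'.
   Both descend to A, where they satisfy the relations of D_4n; the square of s translates by w.
   The rotation r^j moves z' by j/(4n).  If r^j s had a fixed point, then
     z_(2n-1-j-i) + a_(i+j) - z_i
   would be the same 2-torsion class 0 or 1/2 for all i.  For j even, adding the conditions for i
   and 2n-1-j-i gives (j-1)/2 = 0 in E; for j odd, an index with i = 2n-1-j-i makes a_(i+j), which
   is tau/2 up to half integers, equal to 0 or 1/2.  Both are absurd. *)
theory Submission
  imports Defs
begin

section \<open>Presented groups and dihedral words\<close>

declare word_eq.trans [trans]

text \<open>The rules \<open>cancel\<close> and \<open>relator\<close> carry arbitrary contexts, so
  the outer words are absorbed into them.\<close>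

lemma word_eq_context:
  "word_eq R u v \<Longrightarrow> word_eq R (a @ u @ b) (a @ v @ b)"
proof (induction rule: word_eq.induct)
  case (cancel u x b' v)
  show ?case using word_eq.cancel[of R "a @ u" x b' "v @ b"] by simp
next
  case (relator w u v)
  then show ?case using word_eq.relator[of w R "a @ u" "v @ b"] by simp
qed (auto intro: word_eq.intros)

lemma word_eq_append:
  assumes "word_eq R u u'" "word_eq R v v'"
  shows "word_eq R (u @ v) (u' @ v')"
  using word_eq_context[OF assms(1), of "[]" v] word_eq_context[OF assms(2), of u' "[]"]
  by (auto intro: word_eq.trans)

definition word_class :: "'g word set \<Rightarrow> 'g word \<Rightarrow> 'g word set" where
  "word_class R u = {v. word_eq R u v}"

lemma word_class_eq_iff: "word_class R u = word_class R v \<longleftrightarrow> word_eq R u v"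
  unfolding word_class_def by (auto intro: word_eq.intros)

lemma carrier_presented_group: "carrier (presented_group R) = range (word_class R)"
  by (auto simp: presented_group_def quotient_def word_class_def)

lemma one_presented_group: "\<one>\<^bsub>presented_group R\<^esub> = word_class R []"
  by (simp add: presented_group_def word_class_def)

lemma mult_presented_group:
  "word_class R u \<otimes>\<^bsub>presented_group R\<^esub> word_class R v = word_class R (u @ v)"
  unfolding presented_group_def word_class_def
  by (auto intro: word_eq.intros word_eq_append)

definition word_inv :: "'g word \<Rightarrow> 'g word" where
  "word_inv w = rev (map (\<lambda>(x, b). (x, \<not> b)) w)"

lemma word_inv_append: "word_eq R (word_inv w @ w) []"
proof (induction w)
  case Nil
  show ?case by (simp add: word_inv_def word_eq.refl)
next
  case (Cons l w)
  obtain x b where l: "l = (x, b)" by (cases l)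
  have "word_eq R (word_inv w @ [(x, \<not> b), (x, \<not> \<not> b)] @ w) (word_inv w @ w)"
    by (rule word_eq.cancel)
  then show ?case using Cons l by (auto simp: word_inv_def intro: word_eq.trans)
qed

lemma group_presented_group: "group (presented_group R)"
proof (rule groupI)
  fix X assume "X \<in> carrier (presented_group R)"
  then obtain w where "X = word_class R w" by (auto simp: carrier_presented_group)
  then have "word_class R (word_inv w) \<otimes>\<^bsub>presented_group R\<^esub> X = \<one>\<^bsub>presented_group R\<^esub>"
    by (simp add: mult_presented_group one_presented_group word_class_eq_iff word_inv_append)
  then show "\<exists>Y\<in>carrier (presented_group R). Y \<otimes>\<^bsub>presented_group R\<^esub> X = \<one>\<^bsub>presented_group R\<^esub>"
    by (auto simp: carrier_presented_group)
qed (auto simp: carrier_presented_group mult_presented_group one_presented_group)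

section \<open>Normal form of dihedral words\<close>

abbreviation dihedral_rels :: "nat \<Rightarrow> dihedral_gen word set" where
  "dihedral_rels k \<equiv>
    {replicate k (Rot, True),
     [(Ref, True), (Ref, True)],
     [(Rot, True), (Ref, True), (Rot, True), (Ref, True)]}"

abbreviation dihedral_word :: "nat \<Rightarrow> bool \<Rightarrow> dihedral_gen word" where
  "dihedral_word j e \<equiv> replicate j (Rot, True) @ (if e then [(Ref, True)] else [])"

context
  fixes k :: nat
  assumes k: "k \<ge> 1"
begin

abbreviation (input) deq (infix \<open>\<doteq>\<close> 50) where "u \<doteq> v \<equiv> word_eq (dihedral_rels k) u v"

lemma rot_power_period: "replicate (k * q) (Rot, True) \<doteq> []"
proof (induction q)
  case 0
  show ?case by (simp add: word_eq.refl)
next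
  case (Suc q)
  have "replicate k (Rot, True) \<doteq> []"
    using word_eq.relator[of "replicate k (Rot, True)" "dihedral_rels k" "[]" "[]"] by simp
  from word_eq_append[OF this Suc] show ?case by (simp add: replicate_add)
qed

text \<open>The word r^-1 r^k reduces in two ways: r^k can be deleted, or r^-1 can be cancelled
  against the first r.\<close>

lemma rot_inv_power: "[(Rot, False)] \<doteq> replicate (k - 1) (Rot, True)"
proof -
  have "[(Rot, False)] @ replicate (Suc (k - 1)) (Rot, True) \<doteq> [(Rot, False)] @ []"
    using rot_power_period[of 1] k by (intro word_eq_append word_eq.refl) simp
  moreover have "[(Rot, False)] @ replicate (Suc (k - 1)) (Rot, True)
      \<doteq> replicate (k - 1) (Rot, True)"
    using word_eq.cancel[of _ "[]" Rot False "replicate (k - 1) (Rot, True)"] by simp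
  ultimately show ?thesis by (auto intro: word_eq.intros)
qed

lemma ref_ref: "[(Ref, True), (Ref, True)] \<doteq> []"
  using word_eq.relator[of "[(Ref, True), (Ref, True)]" "dihedral_rels k" "[]" "[]"] by simp

lemma ref_inv: "[(Ref, False)] \<doteq> [(Ref, True)]"
proof -
  have "[(Ref, False)] @ [(Ref, True), (Ref, True)] \<doteq> [(Ref, False)] @ []"
    by (intro word_eq_append word_eq.refl ref_ref)
  moreover have "[(Ref, False)] @ [(Ref, True), (Ref, True)] \<doteq> [(Ref, True)]"
    using word_eq.cancel[of _ "[]" Ref False "[(Ref, True)]"] by simp
  ultimately show ?thesis by (auto intro: word_eq.intros)
qed

text \<open>Insert r^-1 r in front and s s behind. The relator r s r s then drops out of the middle
  and leaves r^-1 s.\<close>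

lemma ref_rot: "[(Ref, True), (Rot, True)] \<doteq> replicate (k - 1) (Rot, True) @ [(Ref, True)]"
proof -
  let ?r = "(Rot, True)" and ?s = "(Ref, True)"
  have "[?s, ?r] \<doteq> [(Rot, False), ?r, ?s, ?r]"
    using word_eq.cancel[of "dihedral_rels k" "[]" Rot False "[?s, ?r]"]
    by (auto intro: word_eq.sym)
  also have "[(Rot, False), ?r, ?s, ?r] \<doteq> [(Rot, False), ?r, ?s, ?r] @ [?s, ?s]"
    using word_eq_append[OF word_eq.refl word_eq.sym[OF ref_ref],
        of "[(Rot, False), ?r, ?s, ?r]"] by simp
  also have "[(Rot, False), ?r, ?s, ?r] @ [?s, ?s] \<doteq> [(Rot, False), ?s]"
    using word_eq.relator[of "[?r, ?s, ?r, ?s]" "dihedral_rels k" "[(Rot, False)]" "[?s]"]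
    by simp
  also have "[(Rot, False), ?s] \<doteq> replicate (k - 1) ?r @ [?s]"
    using word_eq_append[OF rot_inv_power word_eq.refl, of "[?s]"] by simp
  finally show ?thesis .
qed

text \<open>This is s r^j = r^-j s, with the exponent written as a natural number.\<close>

lemma ref_rot_power:
  "[(Ref, True)] @ replicate j (Rot, True) \<doteq> replicate ((k - 1) * j) (Rot, True) @ [(Ref, True)]"
proof (induction j)
  case 0
  show ?case by (simp add: word_eq.refl)
next
  case (Suc j)
  let ?r = "(Rot, True)" and ?s = "(Ref, True)"
  have "[?s, ?r] @ replicate j ?r \<doteq> (replicate (k - 1) ?r @ [?s]) @ replicate j ?r"
    by (intro word_eq_append word_eq.refl ref_rot)
  also have "(replicate (k - 1) ?r @ [?s]) @ replicate j ?r
      \<doteq> replicate (k - 1) ?r @ (replicate ((k - 1) * j) ?r @ [?s])"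
    unfolding append_assoc by (intro word_eq_append word_eq.refl Suc)
  finally show ?case by (simp add: replicate_add)
qed

text \<open>Letters are prepended one at a time. Each of the four is equal to a power of r, which
  adds to the exponent, or to s, which moves past the rotations by \<open>ref_rot_power\<close> and
  toggles \<open>e\<close>. The exponent is not reduced modulo k here.\<close>

lemma dihedral_normal_form: "\<exists>j e. w \<doteq> dihedral_word j e"
proof (induction w)
  case Nil
  have "[] \<doteq> dihedral_word 0 False" by (simp add: word_eq.refl)
  then show ?case by blast
next
  case (Cons l w)
  let ?r = "(Rot, True)" and ?s = "(Ref, True)"
  from Cons obtain j e where w: "w \<doteq> dihedral_word j e" by blast
  have step: "l # w \<doteq> v @ dihedral_word j e" if "[l] \<doteq> v" for v
    using word_eq_append[OF that w] by simp
  have rot: "l # w \<doteq> dihedral_word (m + j) e" if "[l] \<doteq> replicate m ?r" for m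
    using step[OF that] by (simp add: replicate_add)
  have ref: "\<exists>j' e'. l # w \<doteq> dihedral_word j' e'" if "[l] \<doteq> [?s]"
  proof -
    let ?i = "(k - 1) * j" and ?t = "if e then [?s] else []"
    have "l # w \<doteq> ([?s] @ replicate j ?r) @ ?t"
      using step[OF that] by simp
    also have "([?s] @ replicate j ?r) @ ?t \<doteq> (replicate ?i ?r @ [?s]) @ ?t"
      by (intro word_eq_append word_eq.refl ref_rot_power)
    also have "(replicate ?i ?r @ [?s]) @ ?t \<doteq> dihedral_word ?i (\<not> e)"
      using word_eq_append[OF word_eq.refl ref_ref, of "replicate ?i ?r"]
      by (auto simp: word_eq.refl)
    finally show ?thesis by blast
  qed
  obtain x b where l: "l = (x, b)" by (cases l)
  have "l = ?r \<or> l = (Rot, False) \<or> l = ?s \<or> l = (Ref, False)"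
    unfolding l by (cases x; cases b) simp_all
  then consider "l = ?r" | "l = (Rot, False)" | "l = ?s" | "l = (Ref, False)"
    by blast
  then show ?case
  proof cases
    case 1
    then have "[l] \<doteq> replicate 1 ?r" by (simp add: word_eq.refl)
    from rot[OF this] show ?thesis by blast
  next
    case 2
    then have "[l] \<doteq> replicate (k - 1) ?r" using rot_inv_power by simp
    from rot[OF this] show ?thesis by blast
  next
    case 3
    then show ?thesis using ref by (simp add: word_eq.refl)
  next
    case 4
    then show ?thesis using ref ref_inv by simp
  qed
qed

end

section \<open>The covering by affine space\<close>

lemma mem_lattice: "x \<in> lattice \<tau> \<longleftrightarrow> (\<exists>a b. x = of_int a + of_int b * \<tau>)"
  by (auto simp: lattice_def)

lemma lattice_zero [simp]: "0 \<in> lattice \<tau>"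
  unfolding mem_lattice by (rule exI[of _ 0], rule exI[of _ 0]) simp

lemma lattice_add: "x \<in> lattice \<tau> \<Longrightarrow> y \<in> lattice \<tau> \<Longrightarrow> x + y \<in> lattice \<tau>"
  unfolding mem_lattice
proof (elim exE)
  fix a b c d :: int assume "x = of_int a + of_int b * \<tau>" "y = of_int c + of_int d * \<tau>"
  then show "\<exists>a b. x + y = of_int a + of_int b * \<tau>"
    by (intro exI[of _ "a + c"] exI[of _ "b + d"]) (simp add: algebra_simps)
qed

lemma lattice_uminus: "x \<in> lattice \<tau> \<Longrightarrow> - x \<in> lattice \<tau>"
  unfolding mem_lattice
proof (elim exE)
  fix a b :: int assume "x = of_int a + of_int b * \<tau>"
  then show "\<exists>a b. - x = of_int a + of_int b * \<tau>"
    by (intro exI[of _ "- a"] exI[of _ "- b"]) simp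
qed

lemma lattice_uminus_iff [simp]: "- x \<in> lattice \<tau> \<longleftrightarrow> x \<in> lattice \<tau>"
  using lattice_uminus[of x] lattice_uminus[of "- x"] by auto

lemma lattice_diff: "x \<in> lattice \<tau> \<Longrightarrow> y \<in> lattice \<tau> \<Longrightarrow> x - y \<in> lattice \<tau>"
  using lattice_add[of x \<tau> "- y"] by simp

lemma lattice_of_int [simp]: "of_int a \<in> lattice \<tau>"
  unfolding mem_lattice by (rule exI[of _ a], rule exI[of _ 0]) simp

lemma lattice_period [simp]: "\<tau> \<in> lattice \<tau>"
  unfolding mem_lattice by (rule exI[of _ 0], rule exI[of _ 1]) simp

lemma of_real_in_lattice:
  assumes "\<tau> \<notin> \<real>" "of_real r \<in> lattice \<tau>"
  shows "r \<in> \<int>"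
proof -
  obtain a b where ab: "complex_of_real r = of_int a + of_int b * \<tau>"
    using assms by (auto simp: mem_lattice)
  have "Im \<tau> \<noteq> 0" using assms by (simp add: complex_is_Real_iff)
  then have "b = 0" using arg_cong[OF ab, of Im] by simp
  then have "r = of_int a" using arg_cong[OF ab, of Re] by simp
  then show ?thesis by simp
qed

text \<open>The real summand does not affect imaginary parts, and these would force the coefficient
  of \<open>\<tau>\<close> to be 1/2.\<close>

lemma half_period_notin_lattice:
  assumes "\<tau> \<notin> \<real>"
  shows "\<tau> / 2 + of_real r \<notin> lattice \<tau>"
proof
  assume "\<tau> / 2 + of_real r \<in> lattice \<tau>"
  then obtain a b where ab: "\<tau> / 2 + of_real r = of_int a + of_int b * \<tau>"
    by (auto simp: mem_lattice)
  have "Im \<tau> \<noteq> 0" using assms by (simp add: complex_is_Real_iff)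
  moreover have "Im \<tau> / 2 = of_int b * Im \<tau>" using arg_cong[OF ab, of Im] by simp
  ultimately have "of_int (2 * b) = (1 :: real)" by (simp add: field_simps)
  then have "2 * b = 1" by linarith
  then show False by presburger
qed

lemma lattice_discrete:
  assumes "\<tau> \<notin> \<real>"
  obtains \<epsilon> where "\<epsilon> > 0" "\<And>x. x \<in> lattice \<tau> \<Longrightarrow> norm x < \<epsilon> \<Longrightarrow> x = 0"
proof
  have Im: "Im \<tau> \<noteq> 0" using assms by (simp add: complex_is_Real_iff)
  \<comment> \<open>The bound on the imaginary part forces \<open>b = 0\<close>; then x is the
    integer \<open>a\<close>, and the bound 1 forces \<open>a = 0\<close>.\<close>
  then show "min 1 \<bar>Im \<tau>\<bar> > 0" by simp
  fix x assume x: "x \<in> lattice \<tau>" "norm x < min 1 \<bar>Im \<tau>\<bar>"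
  then obtain a b where ab: "x = of_int a + of_int b * \<tau>" by (auto simp: mem_lattice)
  have "\<bar>of_int b\<bar> * \<bar>Im \<tau>\<bar> < 1 * \<bar>Im \<tau>\<bar>"
    using x(2) abs_Im_le_cmod[of x] by (simp add: ab abs_mult)
  then have "\<bar>of_int b :: real\<bar> < 1" using Im by (simp only: mult_less_cancel_right)
  then have b: "b = 0" by linarith
  then have "\<bar>of_int a :: real\<bar> < 1" using x(2) by (simp add: ab)
  then have "a = 0" by linarith
  with b ab show "x = 0" by simp
qed

section \<open>The elliptic curves and their product in coordinates\<close>

lemma comm_group_complex_add: "comm_group complex_add"
  by (rule comm_groupI) (auto simp: complex_add_def intro: exI[of _ "- _"])

lemma subgroup_lattice: "subgroup (lattice \<tau>) complex_add"
proof -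
  interpret comm_group complex_add by (rule comm_group_complex_add)
  have "inv\<^bsub>complex_add\<^esub> x = - x" for x
    by (rule inv_equality) (auto simp: complex_add_def)
  then show ?thesis
    by (intro subgroup.intro)
      (auto simp: complex_add_def lattice_add)
qed

lemma comm_group_elliptic: "comm_group (elliptic \<tau>)"
  unfolding elliptic_def
  using comm_group.abelian_FactGroup[OF comm_group_complex_add subgroup_lattice] .

lemma carrier_elliptic: "carrier (elliptic \<tau>) = range (elliptic_pt \<tau>)"
  by (simp add: elliptic_def carrier_FactGroup elliptic_pt_def complex_add_def)

lemma mem_elliptic_pt: "x \<in> elliptic_pt \<tau> z \<longleftrightarrow> x - z \<in> lattice \<tau>"
  by (force simp: elliptic_pt_def r_coset_def complex_add_def)

lemma elliptic_pt_eq_iff: "elliptic_pt \<tau> z = elliptic_pt \<tau> y \<longleftrightarrow> z - y \<in> lattice \<tau>"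
proof
  assume "elliptic_pt \<tau> z = elliptic_pt \<tau> y"
  then have "z \<in> elliptic_pt \<tau> y" by (auto simp: mem_elliptic_pt)
  then show "z - y \<in> lattice \<tau>" by (simp add: mem_elliptic_pt)
next
  assume *: "z - y \<in> lattice \<tau>"
  have "x - z \<in> lattice \<tau> \<longleftrightarrow> x - y \<in> lattice \<tau>" for x
    using lattice_add[OF _ *, of "x - z"] lattice_diff[OF _ *, of "x - y"] by auto
  then show "elliptic_pt \<tau> z = elliptic_pt \<tau> y" by (auto simp: mem_elliptic_pt)
qed

lemma mult_elliptic:
  "elliptic_pt \<tau> z \<otimes>\<^bsub>elliptic \<tau>\<^esub> elliptic_pt \<tau> y = elliptic_pt \<tau> (z + y)"
proof -
  interpret comm_group complex_add by (rule comm_group_complex_add)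
  interpret normal "lattice \<tau>" complex_add
    by (rule subgroup_imp_normal[OF subgroup_lattice])
  show ?thesis
    using rcos_sum[of z y] by (simp add: elliptic_def elliptic_pt_def) (simp add: complex_add_def)
qed

text \<open>The first stage of \<open>proj\<close>: the covering of the product of curves, before w
  is divided out.\<close>

definition cover_proj :: "complex \<Rightarrow> complex \<Rightarrow> complex ^ ('m::finite option) \<Rightarrow> 'm cover_pt" where
  "cover_proj \<tau> \<tau>' z = ((\<lambda>i. elliptic_pt \<tau> (z $ Some i)), elliptic_pt \<tau>' (z $ None))"

lemma cover_proj_eq_iff:
  "cover_proj \<tau> \<tau>' z = cover_proj \<tau> \<tau>' y \<longleftrightarrow>
    (\<forall>i. z $ Some i - y $ Some i \<in> lattice \<tau>) \<and> z $ None - y $ None \<in> lattice \<tau>'"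
  by (auto simp: cover_proj_def fun_eq_iff elliptic_pt_eq_iff)

lemma mult_cover_proj:
  "cover_proj \<tau> \<tau>' z \<otimes>\<^bsub>cover_group \<tau> \<tau>'\<^esub> cover_proj \<tau> \<tau>' y = cover_proj \<tau> \<tau>' (z + y)"
  by (simp add: cover_proj_def cover_group_def mult_elliptic restrict_def)

lemma carrier_cover_group: "carrier (cover_group \<tau> \<tau>') = range (cover_proj \<tau> \<tau>')"
proof
  show "range (cover_proj \<tau> \<tau>') \<subseteq> carrier (cover_group \<tau> \<tau>')"
    by (auto simp: cover_proj_def cover_group_def carrier_elliptic)
  show "carrier (cover_group \<tau> \<tau>') \<subseteq> range (cover_proj \<tau> \<tau>' :: _ \<Rightarrow> 'a cover_pt)"
  proof
    fix x :: "'a cover_pt" assume x: "x \<in> carrier (cover_group \<tau> \<tau>')"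
    have "\<forall>i. \<exists>c. fst x i = elliptic_pt \<tau> c" and "\<exists>d. snd x = elliptic_pt \<tau>' d"
      using x by (auto simp: cover_group_def carrier_elliptic PiE_iff image_iff)
    then obtain c d where "\<forall>i. fst x i = elliptic_pt \<tau> (c i)" "snd x = elliptic_pt \<tau>' d"
      by metis
    then have "x = cover_proj \<tau> \<tau>' (\<chi> i. case i of None \<Rightarrow> d | Some k \<Rightarrow> c k)"
      by (auto simp: cover_proj_def prod_eq_iff)
    then show "x \<in> range (cover_proj \<tau> \<tau>')" by blast
  qed
qed

lemma comm_group_cover_group: "comm_group (cover_group \<tau> \<tau>' :: 'm::finite cover_pt monoid)"
proof -
  have "group (cover_group \<tau> \<tau>' :: 'm cover_pt monoid)"
    unfolding cover_group_def
    by (intro DirProd_group product_group comm_group.axioms(2) comm_group_elliptic)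
  then show ?thesis
    by (rule group.group_comm_groupI) (auto simp: carrier_cover_group mult_cover_proj add.commute)
qed

definition half_vec :: "complex ^ ('m::finite option)" where
  "half_vec = (\<chi> i. case i of None \<Rightarrow> 0 | Some _ \<Rightarrow> 1 / 2)"

lemma half_vec_nth [simp]: "half_vec $ None = 0" "half_vec $ Some i = 1 / 2"
  by (simp_all add: half_vec_def)

lemma w_pt_eq: "w_pt \<tau> \<tau>' = cover_proj \<tau> \<tau>' half_vec"
  by (simp add: w_pt_def cover_proj_def)

text \<open>The image of 0 is idempotent, and a group has only one idempotent.\<close>

lemma one_cover_group: "\<one>\<^bsub>cover_group \<tau> \<tau>'\<^esub> = cover_proj \<tau> \<tau>' (0 :: complex ^ ('m::finite option))"
proof -
  interpret comm_group "cover_group \<tau> \<tau>' :: 'm cover_pt monoid" by (rule comm_group_cover_group)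
  have "cover_proj \<tau> \<tau>' (0 :: complex ^ ('m option)) \<in> carrier (cover_group \<tau> \<tau>')"
    by (simp add: carrier_cover_group)
  then show ?thesis using mult_cover_proj[of \<tau> \<tau>' 0 0] r_cancel_one[of "cover_proj \<tau> \<tau>' 0"]
    by (metis add_0)
qed

text \<open>Since 1/2 + 1/2 is a lattice vector, w is its own inverse, so the pair is already a
  subgroup.\<close>

lemma generate_w_pt:
  "generate (cover_group \<tau> \<tau>') {w_pt \<tau> \<tau>'} =
    {cover_proj \<tau> \<tau>' 0, cover_proj \<tau> \<tau>' (half_vec :: complex ^ ('m::finite option))}"
  (is "?gen = {?o, ?w}")
proof
  interpret comm_group "cover_group \<tau> \<tau>' :: 'm cover_pt monoid" by (rule comm_group_cover_group)
  have carr: "?o \<in> carrier (cover_group \<tau> \<tau>')" "?w \<in> carrier (cover_group \<tau> \<tau>')"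
    by (auto simp: carrier_cover_group)
  have ww: "?w \<otimes>\<^bsub>cover_group \<tau> \<tau>'\<^esub> ?w = ?o"
    using lattice_of_int[of 1 \<tau>] by (simp add: mult_cover_proj cover_proj_eq_iff)
  then have "inv\<^bsub>cover_group \<tau> \<tau>'\<^esub> ?w = ?w"
    using carr by (intro inv_equality) (auto simp: one_cover_group)
  then have "subgroup {?o, ?w} (cover_group \<tau> \<tau>')"
    using carr ww inv_one by (intro subgroup.intro) (auto simp: one_cover_group[symmetric])
  then show "?gen \<subseteq> {?o, ?w}"
    by (intro generate_subgroup_incl) (auto simp: w_pt_eq)
  show "{?o, ?w} \<subseteq> ?gen"
    using generate.one[of "cover_group \<tau> \<tau>'"] generate.incl[of "?w" "{?w}"]
    by (auto simp: one_cover_group w_pt_eq)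
qed

section \<open>The deck group of the universal covering of A\<close>

lemma proj_eq: "proj \<tau> \<tau>' z = {cover_proj \<tau> \<tau>' z, cover_proj \<tau> \<tau>' (half_vec + z)}"
  by (auto simp: proj_def generate_w_pt r_coset_def mult_cover_proj simp flip: cover_proj_def)

text \<open>The kernel of \<open>proj\<close>. The number \<open>\<delta>\<close> tells whether w
  takes part, which is why it is common to all coordinates of the power of E.\<close>

definition deck :: "complex \<Rightarrow> complex \<Rightarrow> (complex ^ ('m::finite option)) set" where
  "deck \<tau> \<tau>' = {v. v $ None \<in> lattice \<tau>' \<and>
    (\<exists>\<delta>\<in>{0, 1/2}. \<forall>i. v $ Some i - \<delta> \<in> lattice \<tau>)}"

lemma two_delta_in_lattice: "\<delta> \<in> {0, 1/2} \<Longrightarrow> 2 * \<delta> \<in> lattice \<tau>"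
  using lattice_of_int[of 1 \<tau>] by (elim insertE emptyE; hypsubst) simp_all

text \<open>Points of A are pairs {z, z + w}, and two such pairs agree iff z equals y or y + w in
  the product of curves. The fact \<open>half\<close> makes this symmetric, as 1/2 and -1/2 differ
  by a lattice vector. From here on, identities in A become membership in
  \<open>deck\<close>.\<close>

lemma proj_eq_iff: "proj \<tau> \<tau>' z = proj \<tau> \<tau>' y \<longleftrightarrow> z - y \<in> deck \<tau> \<tau>'"
proof -
  have half: "x + 1/2 \<in> lattice \<tau> \<longleftrightarrow> x - 1/2 \<in> lattice \<tau>" for x
    using lattice_add[of "x - 1/2" \<tau> 1] lattice_diff[of "x + 1/2" \<tau> 1] lattice_of_int[of 1 \<tau>]
    by (auto simp: algebra_simps)
  have deck: "z - y \<in> deck \<tau> \<tau>' \<longleftrightarrow>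
      cover_proj \<tau> \<tau>' z = cover_proj \<tau> \<tau>' y \<or> cover_proj \<tau> \<tau>' z = cover_proj \<tau> \<tau>' (half_vec + y)"
    by (auto simp: deck_def cover_proj_eq_iff algebra_simps)
  have "cover_proj \<tau> \<tau>' z = cover_proj \<tau> \<tau>' (half_vec + y) \<longleftrightarrow>
      cover_proj \<tau> \<tau>' (half_vec + z) = cover_proj \<tau> \<tau>' y"
    using half[of "z $ Some _ - y $ Some _"] by (auto simp: cover_proj_eq_iff algebra_simps)
  moreover have "cover_proj \<tau> \<tau>' z = cover_proj \<tau> \<tau>' y \<longleftrightarrow>
      cover_proj \<tau> \<tau>' (half_vec + z) = cover_proj \<tau> \<tau>' (half_vec + y)"
    by (auto simp: cover_proj_eq_iff algebra_simps)
  ultimately show ?thesis unfolding deck proj_eq by (auto simp: doubleton_eq_iff)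
qed

text \<open>The subgroup laws for \<open>deck\<close> are the reflexivity, symmetry and transitivity
  of equality of images under \<open>proj\<close>.\<close>

lemma deck_zero [simp]: "0 \<in> deck \<tau> \<tau>'"
  using proj_eq_iff[of \<tau> \<tau>' 0 0] by simp

lemma deck_uminus: "v \<in> deck \<tau> \<tau>' \<Longrightarrow> - v \<in> deck \<tau> \<tau>'"
  using proj_eq_iff[of \<tau> \<tau>' v 0] proj_eq_iff[of \<tau> \<tau>' 0 v] by auto

lemma deck_add: "u \<in> deck \<tau> \<tau>' \<Longrightarrow> v \<in> deck \<tau> \<tau>' \<Longrightarrow> u + v \<in> deck \<tau> \<tau>'"
  using proj_eq_iff[of \<tau> \<tau>' u 0] proj_eq_iff[of \<tau> \<tau>' 0 "- v"] proj_eq_iff[of \<tau> \<tau>' u "- v"] by auto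

lemma deck_diff: "u \<in> deck \<tau> \<tau>' \<Longrightarrow> v \<in> deck \<tau> \<tau>' \<Longrightarrow> u - v \<in> deck \<tau> \<tau>'"
  using deck_add[of u \<tau> \<tau>' "- v"] deck_uminus[of v] by auto

lemma carrier_abvar: "carrier (abvar \<tau> \<tau>') = range (proj \<tau> \<tau>')"
  by (auto simp: abvar_def carrier_FactGroup carrier_cover_group proj_def cover_proj_def)

lemma mult_abvar: "proj \<tau> \<tau>' z \<otimes>\<^bsub>abvar \<tau> \<tau>'\<^esub> proj \<tau> \<tau>' y = proj \<tau> \<tau>' (z + y :: complex ^ ('m::finite option))"
proof -
  interpret comm_group "cover_group \<tau> \<tau>' :: 'm cover_pt monoid" by (rule comm_group_cover_group)
  let ?H = "generate (cover_group \<tau> \<tau>') {w_pt \<tau> \<tau>'} :: 'm cover_pt set"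
  have "subgroup ?H (cover_group \<tau> \<tau>')"
    by (rule generate_is_subgroup) (auto simp: w_pt_eq carrier_cover_group)
  then interpret normal ?H "cover_group \<tau> \<tau>'" by (rule subgroup_imp_normal)
  have "proj \<tau> \<tau>' v = ?H #>\<^bsub>cover_group \<tau> \<tau>'\<^esub> cover_proj \<tau> \<tau>' v" for v
    by (simp add: proj_def cover_proj_def)
  then show ?thesis
    using rcos_sum[of "cover_proj \<tau> \<tau>' z" "cover_proj \<tau> \<tau>' y"]
    by (simp add: abvar_def carrier_cover_group mult_cover_proj)
qed

lemma deck_discrete:
  assumes "\<tau> \<notin> \<real>" "\<tau>' \<notin> \<real>"
  obtains \<epsilon> where "\<epsilon> > 0" "\<And>v :: complex ^ ('m::finite option). v \<in> deck \<tau> \<tau>' \<Longrightarrow> norm v < \<epsilon> \<Longrightarrow> v = 0"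
proof -
  obtain \<epsilon> where \<epsilon>: "\<epsilon> > 0" "\<And>x. x \<in> lattice \<tau> \<Longrightarrow> norm x < \<epsilon> \<Longrightarrow> x = 0"
    using lattice_discrete[OF assms(1)] by blast
  obtain \<epsilon>' where \<epsilon>': "\<epsilon>' > 0" "\<And>x. x \<in> lattice \<tau>' \<Longrightarrow> norm x < \<epsilon>' \<Longrightarrow> x = 0"
    using lattice_discrete[OF assms(2)] by blast
  show thesis
  proof
    \<comment> \<open>The first bound is halved because a coordinate of a deck vector may lie in 1/2
      plus the lattice; only its double is sure to be a lattice vector.\<close>
    show "min (\<epsilon> / 2) \<epsilon>' > 0" using \<epsilon> \<epsilon>' by simp
    fix v :: "complex ^ ('m option)" assume v: "v \<in> deck \<tau> \<tau>'" "norm v < min (\<epsilon> / 2) \<epsilon>'"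
    have small: "norm (v $ i) < min (\<epsilon> / 2) \<epsilon>'" for i
      using v(2) Finite_Cartesian_Product.norm_nth_le[of v i] by simp
    have "v $ Some i = 0" for i
    proof -
      obtain \<delta> where \<delta>: "\<delta> \<in> {0, 1/2}" "v $ Some i - \<delta> \<in> lattice \<tau>"
        using v(1) unfolding deck_def by blast
      have "2 * (v $ Some i) \<in> lattice \<tau>"
        using lattice_add[OF lattice_add[OF \<delta>(2) \<delta>(2)] two_delta_in_lattice[OF \<delta>(1)]]
        by (simp add: algebra_simps)
      then show ?thesis using \<epsilon>(2)[of "2 * (v $ Some i)"] small[of "Some i"] by (simp add: norm_mult)
    qed
    moreover have "v $ None = 0"
      using v(1) \<epsilon>'(2)[of "v $ None"] small[of None] by (simp add: deck_def)
    ultimately have "v $ i = 0" for i by (cases i) auto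
    then show "v = 0" by (simp add: vec_eq_iff)
  qed
qed

section \<open>Descent of affine maps\<close>

definition complex_differentiable :: "(complex ^ 'k::finite \<Rightarrow> complex ^ 'l::finite) \<Rightarrow> bool" where
  "complex_differentiable F \<longleftrightarrow>
    (\<forall>z. \<exists>D. (F has_derivative D) (at z) \<and> (\<forall>c v. D (c *s v) = c *s D v))"

lemma complex_differentiable_id: "complex_differentiable (\<lambda>z. z)"
  unfolding complex_differentiable_def by (intro allI exI[of _ "\<lambda>z. z"]) auto

lemma complex_differentiable_comp:
  assumes "complex_differentiable F" "complex_differentiable G"
  shows "complex_differentiable (F \<circ> G)"
  unfolding complex_differentiable_def
proof
  fix z
  obtain D where D: "(G has_derivative D) (at z)" "\<And>c v. D (c *s v) = c *s D v"
    using assms(2) unfolding complex_differentiable_def by blast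
  obtain D' where D': "(F has_derivative D') (at (G z))" "\<And>c v. D' (c *s v) = c *s D' v"
    using assms(1) unfolding complex_differentiable_def by blast
  have "(F \<circ> G has_derivative D' \<circ> D) (at z)"
    by (rule diff_chain_at[OF D(1) D'(1)])
  then show "\<exists>D. (F \<circ> G has_derivative D) (at z) \<and> (\<forall>c v. D (c *s v) = c *s D v)"
    using D(2) D'(2) by (intro exI[of _ "D' \<circ> D"]) auto
qed

lemma complex_differentiable_funpow:
  fixes F :: "complex ^ 'k::finite \<Rightarrow> complex ^ 'k"
  shows "complex_differentiable F \<Longrightarrow> complex_differentiable (F ^^ j)"
proof (induction j)
  case 0
  show ?case by (simp add: complex_differentiable_id id_def)
qed (simp add: complex_differentiable_comp)

text \<open>Additivity and complex homogeneity make \<open>D\<close> real linear, hence bounded in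
  finite dimension, so \<open>D\<close> is its own derivative and that of every translate
  \<open>D z + b\<close>.\<close>

lemma complex_differentiable_affine:
  fixes D :: "complex ^ 'k::finite \<Rightarrow> complex ^ 'l::finite"
  assumes add: "\<And>u v. D (u + v) = D u + D v" and scale: "\<And>c v. D (c *s v) = c *s D v"
    and F: "\<And>z. F z = D z + b"
  shows "complex_differentiable F"
proof -
  have scaleR: "r *\<^sub>R v = complex_of_real r *s v" for r and v :: "complex ^ 'i::finite"
    unfolding vec_eq_iff vector_scaleR_component vector_smult_component by (simp add: scaleR_conv_of_real)
  have "linear D"
    by (rule linearI) (simp_all add: add scale scaleR)
  then have "(D has_derivative D) (at z)" for z
    by (simp add: linear_conv_bounded_linear bounded_linear_imp_has_derivative)
  then have "(F has_derivative D) (at z)" for z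
    unfolding F[abs_def] by (auto intro: has_derivative_add_const)
  with scale show ?thesis unfolding complex_differentiable_def by blast
qed

text \<open>Exactly what descent to A requires. F need not commute with deck translations;
  \<open>reflect\<close>, for instance, inverts those of the last coordinate.\<close>

definition equivariant ::
    "complex \<Rightarrow> complex \<Rightarrow> (complex ^ ('m::finite option) \<Rightarrow> complex ^ ('m option)) \<Rightarrow> bool" where
  "equivariant \<tau> \<tau>' F \<longleftrightarrow> (\<forall>z y. z - y \<in> deck \<tau> \<tau>' \<longrightarrow> F z - F y \<in> deck \<tau> \<tau>')"

lemma equivariant_comp:
  "equivariant \<tau> \<tau>' F \<Longrightarrow> equivariant \<tau> \<tau>' G \<Longrightarrow> equivariant \<tau> \<tau>' (F \<circ> G)"
  by (simp add: equivariant_def)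

lemma equivariant_funpow: "equivariant \<tau> \<tau>' F \<Longrightarrow> equivariant \<tau> \<tau>' (F ^^ j)"
proof (induction j)
  case 0
  show ?case by (simp add: equivariant_def)
qed (simp add: equivariant_comp)

text \<open>The restriction to the carrier makes the map extensional, as \<open>Bij\<close>
  demands.\<close>

definition descend ::
    "complex \<Rightarrow> complex \<Rightarrow> (complex ^ ('m::finite option) \<Rightarrow> complex ^ ('m option)) \<Rightarrow>
     'm cover_pt set \<Rightarrow> 'm cover_pt set" where
  "descend \<tau> \<tau>' F = (\<lambda>x\<in>carrier (abvar \<tau> \<tau>'). proj \<tau> \<tau>' (F (SOME z. proj \<tau> \<tau>' z = x)))"

lemma descend_proj:
  assumes "equivariant \<tau> \<tau>' F"
  shows "descend \<tau> \<tau>' F (proj \<tau> \<tau>' z) = proj \<tau> \<tau>' (F z)"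
proof -
  let ?y = "SOME y. proj \<tau> \<tau>' y = proj \<tau> \<tau>' z"
  have "proj \<tau> \<tau>' ?y = proj \<tau> \<tau>' z" by (rule someI) simp
  then have "proj \<tau> \<tau>' (F ?y) = proj \<tau> \<tau>' (F z)"
    using assms by (simp add: proj_eq_iff equivariant_def)
  then show ?thesis by (simp add: descend_def carrier_abvar)
qed

text \<open>In charts on small balls around z and \<open>F z\<close>, the map f is F itself.\<close>

lemma holomorphic_via_lift:
  fixes F :: "complex ^ ('m::finite option) \<Rightarrow> complex ^ ('m option)"
  assumes "\<tau> \<notin> \<real>" "\<tau>' \<notin> \<real>" and F: "complex_differentiable F"
    and f: "\<And>z. f (proj \<tau> \<tau>' z) = proj \<tau> \<tau>' (F z)"
  shows "holomorphic_via (proj \<tau> \<tau>') f"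
  unfolding holomorphic_via_def
proof
  fix z
  obtain \<epsilon> where \<epsilon>: "\<epsilon> > 0"
      "\<And>v :: complex ^ ('m option). v \<in> deck \<tau> \<tau>' \<Longrightarrow> norm v < \<epsilon> \<Longrightarrow> v = 0"
    using deck_discrete[OF assms(1,2)] by blast
  \<comment> \<open>Two points of such a ball are less than \<open>\<epsilon>\<close> apart, so they
    cannot differ by a nonzero deck vector.\<close>
  have inj: "inj_on (proj \<tau> \<tau>') (ball c r)" if "r \<le> \<epsilon> / 2" for c :: "complex ^ ('m option)" and r
  proof (rule inj_onI)
    fix x y assume xy: "x \<in> ball c r" "y \<in> ball c r" "proj \<tau> \<tau>' x = proj \<tau> \<tau>' y"
    have "dist x y < \<epsilon>" using xy(1,2) that dist_triangle2[of x y c] by (simp add: dist_commute)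
    then show "x = y" using \<epsilon>(2)[of "x - y"] xy(3) by (simp add: dist_norm proj_eq_iff)
  qed
  let ?V = "ball (F z) (\<epsilon> / 2)"
  have "continuous (at z) F"
    using F unfolding complex_differentiable_def by (meson has_derivative_continuous)
  then obtain d where d: "d > 0" "\<And>x. dist x z < d \<Longrightarrow> dist (F x) (F z) < \<epsilon> / 2"
    using \<epsilon>(1) unfolding continuous_at_eps_delta by (meson half_gt_zero)
  \<comment> \<open>The radius \<open>d\<close> keeps the image inside \<open>?V\<close>, and
    \<open>\<epsilon> / 2\<close> keeps the covering injective.\<close>
  let ?U = "ball z (min d (\<epsilon> / 2))"
  have FU: "F x \<in> ?V" if "x \<in> ?U" for x
    using d(2)[of x] that by (simp add: dist_commute)
  have chart: "(inv_into ?V (proj \<tau> \<tau>') \<circ> f \<circ> proj \<tau> \<tau>') x = F x" if "x \<in> ?U" for x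
    using inv_into_f_f[OF inj FU[OF that]] by (simp add: f)
  have "holomorphic_vec_on (inv_into ?V (proj \<tau> \<tau>') \<circ> f \<circ> proj \<tau> \<tau>') ?U"
    unfolding holomorphic_vec_on_def
  proof
    fix x assume x: "x \<in> ?U"
    obtain D where D: "(F has_derivative D) (at x)" "\<forall>c v. D (c *s v) = c *s D v"
      using F unfolding complex_differentiable_def by blast
    have "(inv_into ?V (proj \<tau> \<tau>') \<circ> f \<circ> proj \<tau> \<tau>' has_derivative D) (at x within ?U)"
      by (rule has_derivative_transform[OF x chart has_derivative_at_withinI[OF D(1)]])
    with D(2) show "\<exists>D. (inv_into ?V (proj \<tau> \<tau>') \<circ> f \<circ> proj \<tau> \<tau>' has_derivative D)
        (at x within ?U) \<and> (\<forall>c v. D (c *s v) = c *s D v)"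
      by blast
  qed
  moreover have "f ` proj \<tau> \<tau>' ` ?U \<subseteq> proj \<tau> \<tau>' ` ?V"
    using FU by (auto simp: f)
  moreover have "z \<in> ?U" using d(1) \<epsilon>(1) by simp
  ultimately show "\<exists>U V. open U \<and> z \<in> U \<and> inj_on (proj \<tau> \<tau>') U \<and> open V \<and>
      inj_on (proj \<tau> \<tau>') V \<and> f ` proj \<tau> \<tau>' ` U \<subseteq> proj \<tau> \<tau>' ` V \<and>
      holomorphic_vec_on (inv_into V (proj \<tau> \<tau>') \<circ> f \<circ> proj \<tau> \<tau>') U"
    by (intro exI[of _ ?U] exI[of _ ?V] conjI open_ball inj) simp_all
qed

section \<open>The lifts of the generators\<close>

text \<open>The bijection \<open>h\<close> numbers the coordinates of the power of E from 0 to 2n -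
  1, giving the bare index type the order that a rotation needs.\<close>

locale dihedral_torus =
  fixes n :: nat and \<tau> \<tau>' :: complex and h :: "nat \<Rightarrow> 'm::finite"
  assumes n: "n \<ge> 1" and \<tau>: "\<tau> \<notin> \<real>" and \<tau>': "\<tau>' \<notin> \<real>"
    and h: "bij_betw h {..<2 * n} UNIV"
begin

section \<open>Antiperiodic sequences\<close>

abbreviation "N \<equiv> 2 * int n"

text \<open>With all integers as indices, rotation and reflection become substitutions j + 1 and N -
  1 - j, without wrap-around cases.\<close>

definition ext :: "complex ^ ('m option) \<Rightarrow> int \<Rightarrow> complex" where
  "ext z j = (if even (j div N) then 1 else - 1) * z $ Some (h (nat (j mod N)))"

definition idx :: "'m \<Rightarrow> int" where
  "idx i = int (inv_into {..<2 * n} h i)"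

text \<open>Only the values of f on 0, ..., 2n - 1 are kept; \<open>ext\<close> recovers the other
  values when f is antiperiodic.\<close>

definition of_ext :: "(int \<Rightarrow> complex) \<Rightarrow> complex \<Rightarrow> complex ^ ('m option)" where
  "of_ext f c = (\<chi> k. case k of None \<Rightarrow> c | Some i \<Rightarrow> f (idx i))"

lemma N_pos: "N > 0" using n by simp

lemma idx: "0 \<le> idx i" "idx i < N" "h (nat (idx i)) = i"
proof -
  have "i \<in> h ` {..<2 * n}" using h by (simp add: bij_betw_def)
  from inv_into_into[OF this] f_inv_into_f[OF this]
  show "0 \<le> idx i" "idx i < N" "h (nat (idx i)) = i"
    by (auto simp: idx_def)
qed

lemma idx_h: "0 \<le> j \<Longrightarrow> j < N \<Longrightarrow> idx (h (nat j)) = j"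
  using h unfolding idx_def by (subst inv_into_f_f) (auto simp: bij_betw_def nat_less_iff)

lemma of_ext_nth [simp]: "of_ext f c $ None = c" "of_ext f c $ Some i = f (idx i)"
  by (simp_all add: of_ext_def)

lemma ext_idx [simp]: "ext z (idx i) = z $ Some i"
  using idx[of i] by (simp add: ext_def)

lemma antiperiodic_mod:
  fixes f :: "int \<Rightarrow> complex"
  assumes f: "\<And>j. f (j + N) = - f j"
  shows "f j = (if even (j div N) then 1 else - 1) * f (j mod N)"
proof -
  have "f (i + N * q) = (if even q then 1 else - 1) * f i" for i q
  proof (induction q rule: int_induct[where k = 0])
    case base
    show ?case by simp
  next
    case (step1 q)
    then show ?case using f[of "i + N * q"] by (simp add: algebra_simps)
  next
    case (step2 q)
    then show ?case using f[of "i + N * (q - 1)"] by (auto simp: algebra_simps split: if_splits)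
  qed
  from this[of "j mod N" "j div N"] show ?thesis by simp
qed

lemma ext_of_ext:
  assumes f: "\<And>j. f (j + N) = - f j"
  shows "ext (of_ext f c) j = f j"
  using antiperiodic_mod[of f j, OF f] idx_h[of "j mod N"] N_pos by (simp add: ext_def)

lemma ext_period [simp]: "ext z (j + N) = - ext z j"
  using N_pos by (simp add: ext_def)

lemma ext_add [simp]: "ext (z + y) j = ext z j + ext y j"
  and ext_diff [simp]: "ext (z - y) j = ext z j - ext y j"
  and ext_scale [simp]: "ext (c *s z) j = c * ext z j"
  by (auto simp: ext_def)

text \<open>A condition on one period spreads to all indices: the sign change turns
  \<open>\<delta>\<close> into \<open>- \<delta>\<close>, and \<open>2 * \<delta>\<close> is a
  lattice vector.\<close>

lemma mem_deck_iff:
  "v \<in> deck \<tau> \<tau>' \<longleftrightarrow>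
    v $ None \<in> lattice \<tau>' \<and> (\<exists>\<delta>\<in>{0, 1/2}. \<forall>j. ext v j - \<delta> \<in> lattice \<tau>)"
proof -
  have "(\<forall>i. v $ Some i - \<delta> \<in> lattice \<tau>) \<longleftrightarrow> (\<forall>j. ext v j - \<delta> \<in> lattice \<tau>)"
    if \<delta>: "\<delta> \<in> {0, 1/2}" for \<delta>
  proof
    assume L: "\<forall>i. v $ Some i - \<delta> \<in> lattice \<tau>"
    have "- (v $ Some i) - \<delta> \<in> lattice \<tau>" for i
    proof -
      have eq: "- (v $ Some i) - \<delta> = - (v $ Some i - \<delta>) - 2 * \<delta>" by simp
      show ?thesis
        unfolding eq
        by (rule lattice_diff[OF lattice_uminus[OF L[rule_format]] two_delta_in_lattice[OF \<delta>]])
    qed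
    with L show "\<forall>j. ext v j - \<delta> \<in> lattice \<tau>" by (simp add: ext_def)
  next
    assume "\<forall>j. ext v j - \<delta> \<in> lattice \<tau>"
    then show "\<forall>i. v $ Some i - \<delta> \<in> lattice \<tau>" by (metis ext_idx)
  qed
  then show ?thesis unfolding deck_def by blast
qed

lemma deckI: "v $ None \<in> lattice \<tau>' \<Longrightarrow> (\<And>j. ext v j \<in> lattice \<tau>) \<Longrightarrow> v \<in> deck \<tau> \<tau>'"
  unfolding mem_deck_iff by auto

section \<open>The lifts of r and s and their relations modulo \<open>deck\<close>\<close>

definition rot :: "complex ^ ('m option) \<Rightarrow> complex ^ ('m option)" where
  "rot z = of_ext (\<lambda>j. ext z (j + 1)) (z $ None + 1 / (4 * of_nat n))"

text \<open>The sequence (tau + j)/2 is antiperiodic only modulo the lattice. Its values on one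
  period are taken here, so that \<open>ext shift\<close> is truly antiperiodic and
  \<open>ext_of_ext\<close> applies to \<open>reflect\<close>.\<close>

definition shift :: "complex ^ ('m option)" where
  "shift = of_ext (\<lambda>j. \<tau> / 2 + of_int j / 2) 0"

definition reflect :: "complex ^ ('m option) \<Rightarrow> complex ^ ('m option)" where
  "reflect z = of_ext (\<lambda>j. ext z (N - 1 - j) + ext shift j) (- z $ None)"

lemma shift_None [simp]: "shift $ None = 0"
  by (simp add: shift_def)

lemma rot_None [simp]: "rot z $ None = z $ None + 1 / (4 * of_nat n)"
  by (simp add: rot_def)

lemma reflect_None [simp]: "reflect z $ None = - z $ None"
  by (simp add: reflect_def)

lemma ext_rot [simp]: "ext (rot z) j = ext z (j + 1)"
  unfolding rot_def
proof (rule ext_of_ext)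
  show "ext z (j + N + 1) = - ext z (j + 1)" for j
    using ext_period[of z "j + 1"] by (simp add: algebra_simps)
qed

lemma ext_reflect [simp]: "ext (reflect z) j = ext z (N - 1 - j) + ext shift j"
  unfolding reflect_def
proof (rule ext_of_ext)
  show "ext z (N - 1 - (j + N)) + ext shift (j + N) = - (ext z (N - 1 - j) + ext shift j)" for j
    using ext_period[of z "N - 1 - (j + N)"] ext_period[of shift j] by (simp add: algebra_simps)
qed

text \<open>Replacing j by its residue m changes j/2 by the integer n q, where q is the quotient.
  For odd q the sign change costs a further tau + m, also a lattice vector.\<close>

lemma ext_shift: "ext shift j - (\<tau> / 2 + of_int j / 2) \<in> lattice \<tau>"
proof -
  let ?m = "j mod N" and ?q = "j div N"
  have j: "of_int j = (2 * of_nat n * of_int ?q + of_int ?m :: complex)"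
    using arg_cong[OF mult_div_mod_eq[of N j, symmetric], of "of_int :: int \<Rightarrow> complex"]
    by (simp only: of_int_add of_int_mult of_int_numeral of_int_of_nat_eq)
  have "ext shift j = (if even ?q then 1 else - 1) * (\<tau> / 2 + of_int ?m / 2)"
    using N_pos idx_h[of ?m] by (simp add: ext_def shift_def)
  then have "ext shift j - (\<tau> / 2 + of_int j / 2) =
      (if even ?q then of_int (- int n * ?q) else of_int (- int n * ?q - ?m) - \<tau>)"
    by (simp add: j add_divide_distrib algebra_simps)
  also have "\<dots> \<in> lattice \<tau>"
    using lattice_diff[OF lattice_of_int lattice_period] lattice_of_int by presburger
  finally show ?thesis .
qed

text \<open>The two halves of tau add up to a period, and (i + j)/2 is an integer.\<close>

lemma ext_shift_add:
  assumes "even (i + j)"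
  shows "ext shift i + ext shift j \<in> lattice \<tau>"
proof -
  obtain m where m: "i + j = 2 * m" using assms by (rule evenE)
  have "of_int i + of_int j = (2 * of_int m :: complex)"
    using arg_cong[OF m, of "of_int :: int \<Rightarrow> complex"] by simp
  then have "ext shift i + ext shift j =
      (ext shift i - (\<tau> / 2 + of_int i / 2)) + (ext shift j - (\<tau> / 2 + of_int j / 2)) + (\<tau> + of_int m)"
    by (simp add: algebra_simps flip: add_divide_distrib)
  also have "\<dots> \<in> lattice \<tau>"
    by (intro lattice_add ext_shift lattice_period lattice_of_int)
  finally show ?thesis .
qed

lemma complex_differentiable_rot: "complex_differentiable rot"
proof (rule complex_differentiable_affine)
  show "rot z = of_ext (\<lambda>j. ext z (j + 1)) (z $ None) + of_ext (\<lambda>_. 0) (1 / (4 * of_nat n))" for z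
    by (simp add: vec_eq_iff rot_def of_ext_def split: option.split)
qed (simp_all add: of_ext_def vec_eq_iff split: option.split)

lemma complex_differentiable_reflect: "complex_differentiable reflect"
proof (rule complex_differentiable_affine)
  show "reflect z = of_ext (\<lambda>j. ext z (N - 1 - j)) (- z $ None) + shift" for z
    by (simp add: vec_eq_iff reflect_def of_ext_def split: option.split)
qed (simp_all add: of_ext_def vec_eq_iff split: option.split)

text \<open>In the difference of two images the constants cancel and the sequence is merely
  reindexed, so the same \<open>\<delta>\<close> works. The same holds for \<open>reflect\<close>,
  up to a sign on the last coordinate.\<close>

lemma equivariant_rot: "equivariant \<tau> \<tau>' rot"
  unfolding equivariant_def mem_deck_iff by auto

lemma equivariant_reflect: "equivariant \<tau> \<tau>' reflect"
  unfolding equivariant_def mem_deck_iff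
proof (intro allI impI, elim conjE, intro conjI)
  fix z y :: "complex ^ ('m option)" assume "(z - y) $ None \<in> lattice \<tau>'"
  then show "(reflect z - reflect y) $ None \<in> lattice \<tau>'"
    using lattice_uminus[of "(z - y) $ None" \<tau>'] by simp
qed auto

lemma rot_power_None: "(rot ^^ j) z $ None = z $ None + of_nat j / (4 * of_nat n)"
  by (induction j) (auto simp: add_divide_distrib)

lemma ext_rot_power: "ext ((rot ^^ j) z) i = ext z (i + int j)"
  by (induction j arbitrary: i) (auto simp: algebra_simps)

text \<open>Two antiperiods restore the sequence, and the last coordinate has moved by 4n/(4n) =
  1.\<close>

lemma rot_period: "(rot ^^ (4 * n)) z - z \<in> deck \<tau> \<tau>'"
proof (rule deckI)
  show "((rot ^^ (4 * n)) z - z) $ None \<in> lattice \<tau>'"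
    using n lattice_of_int[of 1 \<tau>'] by (simp add: rot_power_None)
  fix j
  have "ext z (j + int (4 * n)) = ext z j"
    using ext_period[of z j] ext_period[of z "j + N"] by (simp add: algebra_simps)
  then show "ext ((rot ^^ (4 * n)) z - z) j \<in> lattice \<tau>"
    by (simp add: ext_rot_power)
qed

text \<open>The indices N - 1 - j and j have an odd sum, so their shifts add up to 1/2 modulo the
  lattice. Hence s has order 2 only after division by w: this is the point where
  \<open>\<delta> = 1/2\<close> is taken.\<close>

lemma reflect_reflect: "reflect (reflect z) - z \<in> deck \<tau> \<tau>'"
  unfolding mem_deck_iff
proof (intro conjI bexI allI)
  show "(reflect (reflect z) - z) $ None \<in> lattice \<tau>'" by simp
  fix j
  have *: "ext shift (N - 1 - j) + ext shift j - 1 / 2 =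
      (ext shift (N - 1 - j) - (\<tau> / 2 + of_int (N - 1 - j) / 2)) + (ext shift j - (\<tau> / 2 + of_int j / 2))
      + (\<tau> + of_int (int n - 1))"
    by (simp add: field_simps)
  have "ext shift (N - 1 - j) + ext shift j - 1 / 2 \<in> lattice \<tau>"
    unfolding * by (intro lattice_add ext_shift lattice_period lattice_of_int)
  then show "ext (reflect (reflect z) - z) j - 1 / 2 \<in> lattice \<tau>" by simp
qed simp

lemma rot_reflect_rot_reflect: "rot (reflect (rot (reflect z))) - z \<in> deck \<tau> \<tau>'"
proof (rule deckI)
  show "(rot (reflect (rot (reflect z))) - z) $ None \<in> lattice \<tau>'" by simp
  fix j
  show "ext (rot (reflect (rot (reflect z))) - z) j \<in> lattice \<tau>"
    \<comment> \<open>The composite returns \<open>ext z j\<close> plus the shifts at N - 1 - j and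
      j + 1, whose indices have the even sum N.\<close>
    using ext_shift_add[of "N - 1 - j" "j + 1"] by (simp add: algebra_simps)
qed

text \<open>Formal inverses go to r^(4n-1) and s, which invert r and s only modulo
  \<open>deck\<close>; on A this is enough.\<close>

fun letter_lift :: "dihedral_gen \<times> bool \<Rightarrow> complex ^ ('m option) \<Rightarrow> complex ^ ('m option)" where
  "letter_lift (Rot, True) = rot"
| "letter_lift (Rot, False) = rot ^^ (4 * n - 1)"
| "letter_lift (Ref, _) = reflect"

primrec lift :: "dihedral_gen word \<Rightarrow> complex ^ ('m option) \<Rightarrow> complex ^ ('m option)" where
  "lift [] = id"
| "lift (l # w) = letter_lift l \<circ> lift w"

lemma lift_append: "lift (u @ v) = lift u \<circ> lift v"
  by (induction u) auto

lemma lift_dihedral_word: "lift (dihedral_word j e) = (rot ^^ j) \<circ> (if e then reflect else id)"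
  by (induction j) (auto simp: fun_eq_iff)

lemma equivariant_lift: "equivariant \<tau> \<tau>' (lift w)"
proof (induction w)
  case Nil
  show ?case by (simp add: equivariant_def)
next
  case (Cons l w)
  have "equivariant \<tau> \<tau>' (letter_lift l)"
    by (cases l rule: letter_lift.cases)
      (simp_all add: equivariant_rot equivariant_reflect equivariant_funpow)
  with Cons show ?case by (simp add: equivariant_def)
qed

lemma complex_differentiable_lift: "complex_differentiable (lift w)"
proof (induction w)
  case Nil
  show ?case by (simp add: complex_differentiable_id id_def)
next
  case (Cons l w)
  have "complex_differentiable (letter_lift l)"
    by (cases l rule: letter_lift.cases)
      (simp_all add: complex_differentiable_rot complex_differentiable_reflect
        complex_differentiable_funpow)
  with Cons show ?case by (simp add: complex_differentiable_comp[unfolded comp_def])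
qed

text \<open>The word v only changes the point at which w is applied, and equivariance of
  \<open>lift u\<close> carries the deck vector through u.\<close>

lemma lift_context:
  assumes "\<And>z. lift w z - z \<in> deck \<tau> \<tau>'"
  shows "lift (u @ w @ v) z - lift (u @ v) z \<in> deck \<tau> \<tau>'"
  using assms[of "lift v z"] equivariant_lift[of u] by (simp add: lift_append equivariant_def)

text \<open>The universal property of the presentation: every rule generating the congruence
  preserves the lift modulo \<open>deck\<close>.\<close>

lemma word_eq_lift:
  "word_eq (dihedral_rels (4 * n)) u v \<Longrightarrow> lift u z - lift v z \<in> deck \<tau> \<tau>'"
proof (induction arbitrary: z rule: word_eq.induct)
  case (sym u v)
  then show ?case using deck_uminus[of "lift u z - lift v z"] by simp
next
  case (trans u v w)
  then show ?case using deck_add[of "lift u z - lift v z" \<tau> \<tau>' "lift v z - lift w z"] by simp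
next
  case (cancel u x b v)
  have "4 * n = Suc (4 * n - 1)" using n by simp
  then have pow: "(rot ^^ (4 * n)) y = rot ((rot ^^ (4 * n - 1)) y)" for y
    by (metis funpow.simps(2) comp_apply)
  have "lift [(x, b), (x, \<not> b)] y - y \<in> deck \<tau> \<tau>'" for y
    using rot_period[of y] reflect_reflect[of y] pow[of y]
    by (cases x; cases b) (auto simp: funpow_swap1)
  then show ?case by (rule lift_context)
next
  case (relator w u v)
  have "lift w y - y \<in> deck \<tau> \<tau>'" for y
    using relator rot_period[of y] reflect_reflect[of y] rot_reflect_rot_reflect[of y]
      lift_dihedral_word[of "4 * n" False] by auto
  then show ?case by (rule lift_context)
qed auto

subsection \<open>The action\<close>

abbreviation "D \<equiv> dihedral (4 * n)"
abbreviation cls :: "dihedral_gen word \<Rightarrow> dihedral_gen word set" where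
  "cls \<equiv> word_class (dihedral_rels (4 * n))"
abbreviation p :: "complex ^ ('m option) \<Rightarrow> 'm cover_pt set" where
  "p \<equiv> proj \<tau> \<tau>'"

definition act :: "dihedral_gen word set \<Rightarrow> 'm cover_pt set \<Rightarrow> 'm cover_pt set" where
  "act X = descend \<tau> \<tau>' (lift (SOME w. cls w = X))"

text \<open>By \<open>word_eq_lift\<close> the word chosen in \<open>act\<close> does not matter, so
  any word of the class computes the action.\<close>

lemma act_proj: "act (cls w) (p z) = p (lift w z)"
proof -
  let ?v = "SOME v. cls v = cls w"
  have "cls ?v = cls w" by (rule someI) simp
  then have "word_eq (dihedral_rels (4 * n)) ?v w" by (simp add: word_class_eq_iff)
  then have "lift ?v z - lift w z \<in> deck \<tau> \<tau>'" by (rule word_eq_lift)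
  then show ?thesis by (simp add: act_def descend_proj equivariant_lift proj_eq_iff)
qed

lemma carrier_D: "carrier D = range cls"
  by (simp add: dihedral_def carrier_presented_group)

lemma group_D: "group D"
  by (simp add: dihedral_def group_presented_group)

lemma mult_D: "cls u \<otimes>\<^bsub>D\<^esub> cls v = cls (u @ v)"
  by (simp add: dihedral_def mult_presented_group)

lemma one_D: "\<one>\<^bsub>D\<^esub> = cls []"
  by (simp add: dihedral_def one_presented_group)

lemma act_mult: "act (cls (u @ v)) (p z) = act (cls u) (act (cls v) (p z))"
  by (simp add: act_proj lift_append)

lemma act_inv:
  "act (cls (word_inv w)) (act (cls w) (p z)) = p z"
  "act (cls w) (act (cls (word_inv w)) (p z)) = p z"
proof -
  have "cls (word_inv w @ w) = cls []" for w
    using word_inv_append by (simp add: word_class_eq_iff)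
  then have inv: "act (cls (word_inv w)) (act (cls w) (p z)) = p z" for w z
    using act_mult[of "word_inv w" w z] act_proj[of "[]" z] by simp
  show "act (cls (word_inv w)) (act (cls w) (p z)) = p z" by (rule inv)
  have "word_inv (word_inv w) = w"
    by (auto simp: word_inv_def rev_map comp_def split_beta)
  then show "act (cls w) (act (cls (word_inv w)) (p z)) = p z"
    using inv[of "word_inv w" z] by simp
qed

lemma bij_act: "bij_betw (act (cls w)) (range p) (range p)"
  by (rule bij_betw_byWitness[where f' = "act (cls (word_inv w))"])
    (use act_inv in \<open>force simp: act_proj\<close>)+

lemma act_Bij: "act (cls w) \<in> Bij (carrier (abvar \<tau> \<tau>'))"
  using bij_act by (simp add: Bij_def carrier_abvar) (simp add: act_def descend_def carrier_abvar)

lemma act_hom: "act \<in> hom D (BijGroup (carrier (abvar \<tau> \<tau>')))"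
proof (rule homI)
  fix X assume "X \<in> carrier D"
  then show "act X \<in> carrier (BijGroup (carrier (abvar \<tau> \<tau>')))"
    using act_Bij by (auto simp: carrier_D BijGroup_def)
next
  fix X Y assume "X \<in> carrier D" "Y \<in> carrier D"
  then obtain u v where uv: "X = cls u" "Y = cls v" by (auto simp: carrier_D)
  have "act (cls (u @ v)) = compose (carrier (abvar \<tau> \<tau>')) (act (cls u)) (act (cls v))"
  proof (rule extensionalityI)
    show "act (cls (u @ v)) \<in> extensional (carrier (abvar \<tau> \<tau>'))"
      using act_Bij by (rule Bij_imp_extensional)
  qed (auto simp: compose_eq carrier_abvar act_mult)
  then show "act (X \<otimes>\<^bsub>D\<^esub> Y) = act X \<otimes>\<^bsub>BijGroup (carrier (abvar \<tau> \<tau>'))\<^esub> act Y"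
    using act_Bij by (simp add: uv mult_D BijGroup_def)
qed

lemma group_action_act: "group_action D (carrier (abvar \<tau> \<tau>')) act"
  unfolding group_action_def group_hom_def group_hom_axioms_def
  using group_D group_BijGroup act_hom by blast

text \<open>The inverse map is the action of the inverse word, so it has a complex differentiable
  lift too.\<close>

lemma biholomorphic_act: "biholomorphic_via p (act (cls w))"
  unfolding biholomorphic_via_def
proof (intro conjI bij_act)
  show "holomorphic_via p (act (cls w))"
    by (rule holomorphic_via_lift[OF \<tau> \<tau>' complex_differentiable_lift act_proj])
  have "inv_into (range p) (act (cls w)) (p z) = p (lift (word_inv w) z)" for z
  proof (rule inv_into_f_eq)
    show "inj_on (act (cls w)) (range p)" using bij_act by (rule bij_betw_imp_inj_on)
    show "act (cls w) (p (lift (word_inv w) z)) = p z"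
      using act_inv(2)[of w z] by (simp add: act_proj)
  qed simp
  then show "holomorphic_via p (inv_into (range p) (act (cls w)))"
    by (rule holomorphic_via_lift[OF \<tau> \<tau>' complex_differentiable_lift])
qed

section \<open>Freeness\<close>

lemma D_normal_form:
  assumes "X \<in> carrier D"
  obtains j e where "X = cls (dihedral_word j e)"
proof -
  obtain w where w: "X = cls w" using assms by (auto simp: carrier_D)
  obtain j e where "word_eq (dihedral_rels (4 * n)) w (dihedral_word j e)"
    using dihedral_normal_form[of "4 * n" w] n by auto
  with w that show thesis by (simp add: word_class_eq_iff)
qed

lemma rotation_eq_one: "4 * n dvd j \<Longrightarrow> cls (dihedral_word j False) = \<one>\<^bsub>D\<^esub>"
  using rot_power_period[of "4 * n"] n by (auto simp: one_D word_class_eq_iff elim!: dvdE)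

text \<open>The last coordinate decides: j/(4n) must be a real element of the lattice, hence an
  integer.\<close>

lemma rotation_free:
  assumes "(rot ^^ j) z - z \<in> deck \<tau> \<tau>'"
  shows "4 * n dvd j"
proof -
  have "complex_of_real (real j / real (4 * n)) \<in> lattice \<tau>'"
    using assms by (simp add: deck_def rot_power_None)
  then have "real j / real (4 * n) \<in> \<int>" by (rule of_real_in_lattice[OF \<tau>'])
  then obtain q where "real j / real (4 * n) = of_int q" by (auto elim: Ints_cases)
  then have "real_of_int (int j) = of_int (int (4 * n) * q)"
    using n by (simp add: field_simps)
  then have "int j = int (4 * n) * q" by (simp only: of_int_eq_iff)
  then have "int (4 * n) dvd int j" by simp
  then show ?thesis by (simp only: int_dvd_int_iff)
qed

lemma reflection_free: "(rot ^^ j) (reflect z) - z \<notin> deck \<tau> \<tau>'"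
proof
  let ?a = "ext shift" and ?z = "ext z"
  \<comment> \<open>The index substitution of r^j s, an involution of the integers. It has a fixed
    index iff j is odd, whence the case distinction.\<close>
  define \<sigma> where "\<sigma> i = N - 1 - (i + int j)" for i
  assume "(rot ^^ j) (reflect z) - z \<in> deck \<tau> \<tau>'"
  then obtain \<delta> where \<delta>: "\<delta> \<in> {0, 1/2}"
    and "\<forall>i. ext ((rot ^^ j) (reflect z) - z) i - \<delta> \<in> lattice \<tau>"
    unfolding mem_deck_iff by blast
  then have eq: "?z (\<sigma> i) + ?a (i + int j) - ?z i - \<delta> \<in> lattice \<tau>" for i
    by (simp add: ext_rot_power \<sigma>_def)
  have shift: "\<tau> / 2 + of_int i / 2 - ?a i \<in> lattice \<tau>" for i
    using lattice_uminus[OF ext_shift[of i]] by simp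
  show False
  proof (cases "even j")
    case True
    \<comment> \<open>Adding the equations for \<open>i\<close> and \<open>\<sigma> i\<close> eliminates \<open>z\<close>.\<close>
    have "\<sigma> (\<sigma> 0) = 0" by (simp add: \<sigma>_def)
    then have eqs: "?z (\<sigma> 0) + ?a (int j) - ?z 0 - \<delta> \<in> lattice \<tau>"
        "?z 0 + ?a (N - 1) - ?z (\<sigma> 0) - \<delta> \<in> lattice \<tau>"
      using eq[of 0] eq[of "\<sigma> 0"] by (simp_all add: \<sigma>_def)
    \<comment> \<open>The second shift has index \<open>\<sigma> 0 + j = N - 1\<close>. Modulo the
      lattice both shifts add up to half of j + N - 1, an odd number when j is even.\<close>
    have sum: "complex_of_real (real_of_int (int j + N - 1) / 2) =
        (?z (\<sigma> 0) + ?a (int j) - ?z 0 - \<delta>) + (?z 0 + ?a (N - 1) - ?z (\<sigma> 0) - \<delta>) + 2 * \<delta>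
        + (\<tau> / 2 + of_int (int j) / 2 - ?a (int j)) + (\<tau> / 2 + of_int (N - 1) / 2 - ?a (N - 1)) - \<tau>"
      by (simp add: field_simps)
    have "complex_of_real (real_of_int (int j + N - 1) / 2) \<in> lattice \<tau>"
      unfolding sum
      by (intro lattice_diff lattice_add eqs two_delta_in_lattice[OF \<delta>] shift lattice_period)
    then have "real_of_int (int j + N - 1) / 2 \<in> \<int>" by (rule of_real_in_lattice[OF \<tau>])
    then obtain q where "real_of_int (int j + N - 1) / 2 = of_int q" by (auto elim: Ints_cases)
    then have "real_of_int (int j + N - 1) = of_int (2 * q)" by simp
    then have "int j + N - 1 = 2 * q" by (simp only: of_int_eq_iff)
    with True show False by presburger
  next
    case False
    \<comment> \<open>Now \<open>\<sigma>\<close> has a fixed index, where the equation says that the shift is \<open>\<delta>\<close>, which its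
      summand \<open>\<tau> / 2\<close> rules out.\<close>
    define i where "i = (N - 1 - int j) div 2"
    have "2 * i = N - 1 - int j" using False by (simp add: i_def)
    then have "\<sigma> i = i" by (simp add: \<sigma>_def)
    then have "?a (i + int j) - \<delta> \<in> lattice \<tau>" using eq[of i] by simp
    from lattice_add[OF this shift[of "i + int j"]]
    have "\<tau> / 2 + (of_int (i + int j) / 2 - \<delta>) \<in> lattice \<tau>" by (simp add: algebra_simps)
    moreover obtain r where "\<delta> = complex_of_real r"
      using \<delta> that[of 0] that[of "1 / 2"] by auto
    ultimately have "\<tau> / 2 + complex_of_real (of_int (i + int j) / 2 - r) \<in> lattice \<tau>" by simp
    then show False using half_period_notin_lattice[OF \<tau>] by blast
  qed
qed

lemma free_act: "free_action D (carrier (abvar \<tau> \<tau>')) act"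
  unfolding free_action_def
proof (intro ballI impI notI)
  fix X x assume X: "X \<in> carrier D" "X \<noteq> \<one>\<^bsub>D\<^esub>"
    and x: "x \<in> carrier (abvar \<tau> \<tau>')" "act X x = x"
  obtain z where z: "x = p z" using x by (auto simp: carrier_abvar)
  obtain j e where je: "X = cls (dihedral_word j e)" using D_normal_form[OF X(1)] .
  have fixed: "lift (dihedral_word j e) z - z \<in> deck \<tau> \<tau>'"
    using x(2) unfolding je z act_proj proj_eq_iff .
  show False
  proof (cases e)
    case True
    then show False using fixed reflection_free unfolding lift_dihedral_word by simp
  next
    case False
    then have "(rot ^^ j) z - z \<in> deck \<tau> \<tau>'" using fixed unfolding lift_dihedral_word by simp
    from rotation_eq_one[OF rotation_free[OF this]] show False using X(2) je False by simp
  qed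
qed

section \<open>Absence of translations\<close>

lemma of_real_notin_deck_coset:
  assumes "v \<in> deck \<tau> \<tau>'" "ext v i = of_real r"
  shows "2 * r \<in> \<int>"
proof -
  obtain \<delta> where \<delta>: "\<delta> \<in> {0, 1/2}" "ext v i - \<delta> \<in> lattice \<tau>"
    using assms(1) unfolding mem_deck_iff by blast
  \<comment> \<open>Doubling removes the unknown \<open>\<delta>\<close>, so only
    \<open>2 * r\<close> is seen to be an integer.\<close>
  have "complex_of_real (2 * r) \<in> lattice \<tau>"
    using lattice_add[OF lattice_add[OF \<delta>(2) \<delta>(2)] two_delta_in_lattice[OF \<delta>(1)]] assms(2)
    by (simp add: algebra_simps)
  then show ?thesis by (rule of_real_in_lattice[OF \<tau>])
qed

lemma not_Ints_fractions: "(1 / 4 :: real) \<notin> \<int>" "(1 / 2 :: real) \<notin> \<int>"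
proof -
  have False if "1 / 4 = real_of_int q \<or> 1 / 2 = real_of_int q" for q
  proof -
    have "real_of_int (4 * q) = of_int 1 \<or> real_of_int (2 * q) = of_int 1" using that by auto
    then have "4 * q = 1 \<or> 2 * q = 1" by (simp only: of_int_eq_iff)
    then show False by presburger
  qed
  then show "(1 / 4 :: real) \<notin> \<int>" "(1 / 2 :: real) \<notin> \<int>" by (blast elim: Ints_cases)+
qed

text \<open>Subtracting the value at 0 leaves the linear part of r^j minus the identity. One test
  vector suffices to show that it vanishes modulo \<open>deck\<close> only for multiples of
  4n.\<close>

lemma rotation_linear_part_trivial:
  assumes "\<And>z. ((rot ^^ j) z - z) - ((rot ^^ j) 0 - 0) \<in> deck \<tau> \<tau>'"
  shows "4 * n dvd j"
proof -
  \<comment> \<open>Entry 0 of the resulting vector is 0 if r^j brings index 0 back with sign +,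
    -1/4 if with sign -, and -1/8 otherwise. The value 1/8 is small enough that the doubles of the
    last two are not integers.\<close>
  define z :: "complex ^ ('m option)" where "z = (\<chi> k. if k = Some (h 0) then 1 / 8 else 0)"
  define v where "v = ((rot ^^ j) z - z) - ((rot ^^ j) 0 - 0)"
  have v: "v \<in> deck \<tau> \<tau>'" unfolding v_def by (rule assms)
  let ?m = "int j mod N" and ?q = "int j div N"
  have ext_0: "ext 0 i = 0" for i by (simp add: ext_def)
  have z0: "ext z 0 = 1 / 8" by (simp add: ext_def z_def)
  have zj: "ext z (int j) = (if ?m = 0 then if even ?q then 1 / 8 else - 1 / 8 else 0)"
  proof -
    have "h (nat ?m) = h 0 \<longleftrightarrow> ?m = 0"
      using idx_h[of ?m] idx_h[of 0] N_pos by (metis nat_0 pos_mod_bound pos_mod_sign order_refl)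
    then show ?thesis by (simp add: ext_def z_def)
  qed
  have v0: "ext v 0 = ext z (int j) - 1 / 8"
    by (simp add: v_def ext_rot_power ext_0 z0)
  have "?m = 0 \<and> even ?q"
  proof (rule ccontr)
    assume "\<not> (?m = 0 \<and> even ?q)"
    then have "ext v 0 = of_real (- 1 / 8) \<or> ext v 0 = of_real (- 1 / 4)"
      unfolding v0 zj by auto
    then have "2 * (- 1 / 8) \<in> (\<int> :: real set) \<or> 2 * (- 1 / 4) \<in> (\<int> :: real set)"
      using of_real_notin_deck_coset[OF v] by blast
    then show False using not_Ints_fractions by simp
  qed
  then have "int j = 2 * N * (?q div 2)" by auto
  then have "int j = int (4 * n) * (?q div 2)" by simp
  then have "int (4 * n) dvd int j" by (rule dvdI)
  then show ?thesis by (simp only: int_dvd_int_iff)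
qed

lemma no_translations_act: "without_translations D (abvar \<tau> \<tau>') act"
  unfolding without_translations_def is_translation_def
proof (intro ballI impI notI, elim bexE)
  fix X t assume X: "X \<in> carrier D" "X \<noteq> \<one>\<^bsub>D\<^esub>" and t: "t \<in> carrier (abvar \<tau> \<tau>')"
    and eq: "\<forall>x\<in>carrier (abvar \<tau> \<tau>'). act X x = x \<otimes>\<^bsub>abvar \<tau> \<tau>'\<^esub> t"
  obtain a where a: "t = p a" using t by (auto simp: carrier_abvar)
  obtain j e where je: "X = cls (dihedral_word j e)" using D_normal_form[OF X(1)] .
  let ?F = "lift (dihedral_word j e)"
  have "?F z - (z + a) \<in> deck \<tau> \<tau>'" for z
    using eq unfolding je a carrier_abvar by (auto simp: act_proj mult_abvar proj_eq_iff)
  \<comment> \<open>Comparison with the point 0 eliminates the translation vector.\<close>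
  from deck_diff[OF this this[of 0]]
  have lin: "(?F z - z) - (?F 0 - 0) \<in> deck \<tau> \<tau>'" for z
    by (simp add: algebra_simps)
  show False
  proof (cases e)
    case True
    \<comment> \<open>On the last coordinate r^j s is -z' plus a constant, so the difference in
      \<open>lin\<close> is -2z'. The choice z' = 1/4 makes it -1/2, which is not in the
      lattice.\<close>
    let ?z = "of_ext (\<lambda>_. 0) (1 / 4)"
    have F: "?F z = (rot ^^ j) (reflect z)" for z
      using True unfolding lift_dihedral_word by simp
    have "complex_of_real (- 1 / 2) \<in> lattice \<tau>'"
      using lin[of ?z] unfolding F by (simp add: deck_def rot_power_None)
    then have "(- 1 / 2 :: real) \<in> \<int>" by (rule of_real_in_lattice[OF \<tau>'])
    then show False using not_Ints_fractions(2) by simp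
  next
    case False
    have F: "?F z = (rot ^^ j) z" for z
      using False unfolding lift_dihedral_word by simp
    show False
      using rotation_eq_one[OF rotation_linear_part_trivial[OF lin[unfolded F]]] X(2) je False
      by simp
  qed
qed

end

theorem mainTheorem1:
  fixes n :: nat and \<tau> \<tau>' :: complex
  assumes "n \<ge> 1"
    and "\<tau> \<notin> \<real>" and "\<tau>' \<notin> \<real>"
    and "CARD('m::finite) = 2 * n"
  shows "\<exists>\<phi> :: dihedral_gen word set \<Rightarrow> 'm cover_pt set \<Rightarrow> 'm cover_pt set.
    acts_by_automorphisms \<tau> \<tau>' (dihedral (4 * n)) \<phi> \<and>
    free_action (dihedral (4 * n)) (carrier (abvar \<tau> \<tau>')) \<phi> \<and>
    without_translations (dihedral (4 * n)) (abvar \<tau> \<tau>') \<phi>"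
proof -
  obtain h :: "nat \<Rightarrow> 'm" where "bij_betw h {..<2 * n} UNIV"
    using ex_bij_betw_nat_finite[of "UNIV :: 'm set"] assms(4) by (auto simp: atLeast0LessThan)
  then interpret dihedral_torus n \<tau> \<tau>' h
    using assms by unfold_locales
  have "acts_by_automorphisms \<tau> \<tau>' (dihedral (4 * n)) act"
    unfolding acts_by_automorphisms_def
    using group_action_act biholomorphic_act by (auto simp: carrier_D)
  with free_act no_translations_act show ?thesis by blast
qed

end
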